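(* Let $A$ be an anticommutative g-alternative algebra over a field $F$ with $\mathrm{Ann}(A)=0$. Then there exists an actor of $A$ in $\mathrm{gAlt}$, and $\mathrm{Act}(A)=\mathrm{Bim}_{\mathrm{gAlt}}(A)$.
   Context: Algebras: an algebra over a field $F$ is an $F$-vector space with an $F$-bilinear multiplication, not assumed associative or unital. $A$ is g-alternative if for all $x,y,z\in A$: $x(yz)=(xy)z+(yx)z-y(xz)$ and $(xy)z=x(yz)+x(zy)-(xz)y$. $\mathrm{gAlt}$ is the category of g-alternative algebras over $F$. $A$ is anticommutative if $aa'=-a'a$ for all $a,a'\in A$. $\mathrm{Ann}(A)=\{z\in A\mid az=za=0\text{ for all }a\in A\}$. Derived actions: an action of an $F$-algebra $B$ on a g-alternative algebra $A$, i.e. a pair of $F$-bilinear maps $B\times A\to A$, $(b,a)\mapsto ba$, and $A\times B\to A$, $(a,b)\mapsto ab$, is a derived action in $\mathrm{gAlt}$ if $B$ is g-alternative and for all $a,a_1,a_2\in A$, $b,b_1,b_2\in B$: $b(a_1a_2)=(ba_1)a_2+(a_1b)a_2-a_1(ba_2)$; $(a_1a_2)b=a_1(a_2b)+a_1(ba_2)-(a_1b)a_2$; $(ba_1)a_2=b(a_1a_2)+b(a_2a_1)-(ba_2)a_1$; $a_1(a_2b)=(a_1a_2)b+(a_2a_1)b-a_2(a_1b)$; $(b_1b_2)a=b_1(b_2a)+b_1(ab_2)-(b_1a)b_2$; $a(b_1b_2)=(ab_1)b_2+(b_1a)b_2-b_1(ab_2)$; $(ab_1)b_2=a(b_1b_2)+a(b_2b_1)-(ab_2)b_1$;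 $b_1(b_2a)=(b_1b_2)a+(b_2b_1)a-b_2(b_1a)$. Actor: an actor of $A$ in $\mathrm{gAlt}$ is a g-alternative algebra $\mathrm{Act}(A)$ with a derived action on $A$ in $\mathrm{gAlt}$ such that for every g-alternative algebra $C$ with a derived action on $A$ there is a unique algebra homomorphism $\varphi\colon C\to\mathrm{Act}(A)$ with $ca=\varphi(c)a$ and $ac=a\varphi(c)$ for all $a\in A$, $c\in C$. $\mathrm{Bim}_{\mathrm{gAlt}}(A)$: for a pair $f$ of $F$-linear maps $A\to A$ write $fa$ for the value of the first map at $a$ and $af$ for the value of the second. Consider all pairs $f$ such that for all $a_1,a_2\in A$: $f(a_1a_2)=(fa_1)a_2+(a_1f)a_2-a_1(fa_2)$; $(a_1a_2)f=a_1(a_2f)+a_1(fa_2)-(a_1f)a_2$; $(fa_1)a_2=f(a_1a_2)+f(a_2a_1)-(fa_2)a_1$; $a_1(a_2f)=(a_1a_2)f+(a_2a_1)f-a_2(a_1f)$. On pairs define addition componentwise and a product $ff'$ by $(ff')a=f(f'a)+f(af')-(fa)f'$, $a(ff')=(af)f'+(fa)f'-f(af')$. $\mathrm{Bim}_{\mathrm{gAlt}}(A)$ is the $F$-algebra consisting of all these pairs together with all pairs obtained from them by repeatedly applying addition and this product (pairs giving the same maps are identified). It acts on $A$ by $(f,a)\mapsto fa$, $(a,f)\mapsto af$. The equality $\mathrm{Act}(A)=\mathrm{Bim}_{\mathrm{gAlt}}(A)$ means that $\mathrm{Bim}_{\mathrm{gAlt}}(A)$ with this action is an actor of $A$. *)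

theory Defs
  imports "HOL-Algebra.Module" "HOL-Library.FuncSet"
begin

text \<open>
  Algebras are neither associative nor unital. They are carried by the record type of
  \<^locale>\<open>module\<close>, whose field for a unit element of the multiplication is present for technical
  reasons only: nothing is assumed about it and it is never used.
\<close>

definition linear_maps ::
  "('k, 'f) ring_scheme \<Rightarrow> ('k, 'a, 'm) module_scheme \<Rightarrow> ('k, 'b, 'n) module_scheme \<Rightarrow> ('a \<Rightarrow> 'b) set"
  where "linear_maps F U V = {g \<in> carrier U \<rightarrow> carrier V.
    (\<forall>x\<in>carrier U. \<forall>y\<in>carrier U. g (x \<oplus>\<^bsub>U\<^esub> y) = g x \<oplus>\<^bsub>V\<^esub> g y) \<and>
    (\<forall>c\<in>carrier F. \<forall>x\<in>carrier U. g (c \<odot>\<^bsub>U\<^esub> x) = c \<odot>\<^bsub>V\<^esub> g x)}"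

definition bilinear_maps ::
  "('k, 'f) ring_scheme \<Rightarrow> ('k, 'a, 'm) module_scheme \<Rightarrow> ('k, 'b, 'n) module_scheme \<Rightarrow>
    ('k, 'c, 'p) module_scheme \<Rightarrow> ('a \<Rightarrow> 'b \<Rightarrow> 'c) set"
  where "bilinear_maps F U V W = {g.
    (\<forall>x\<in>carrier U. g x \<in> linear_maps F V W) \<and>
    (\<forall>y\<in>carrier V. (\<lambda>x. g x y) \<in> linear_maps F U W)}"

locale nonassoc_algebra = field F + module F A for F and A (structure) +
  assumes mult_bilinear: "(\<otimes>) \<in> bilinear_maps F A A A"

definition algebra_homs ::
  "('k, 'f) ring_scheme \<Rightarrow> ('k, 'a, 'm) module_scheme \<Rightarrow> ('k, 'b, 'n) module_scheme \<Rightarrow> ('a \<Rightarrow> 'b) set"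
  where "algebra_homs F A B = {h \<in> linear_maps F A B.
    \<forall>x\<in>carrier A. \<forall>y\<in>carrier A. h (x \<otimes>\<^bsub>A\<^esub> y) = h x \<otimes>\<^bsub>B\<^esub> h y}"

locale g_alternative_algebra = nonassoc_algebra +
  assumes g_alt_left: "\<lbrakk>x \<in> carrier A; y \<in> carrier A; z \<in> carrier A\<rbrakk> \<Longrightarrow>
      x \<otimes> (y \<otimes> z) = (x \<otimes> y) \<otimes> z \<oplus> (y \<otimes> x) \<otimes> z \<ominus> y \<otimes> (x \<otimes> z)"
    and g_alt_right: "\<lbrakk>x \<in> carrier A; y \<in> carrier A; z \<in> carrier A\<rbrakk> \<Longrightarrow>
      (x \<otimes> y) \<otimes> z = x \<otimes> (y \<otimes> z) \<oplus> x \<otimes> (z \<otimes> y) \<ominus> (x \<otimes> z) \<otimes> y"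

definition anticommutative :: "('a, 'm) ring_scheme \<Rightarrow> bool"
  where "anticommutative A \<longleftrightarrow>
    (\<forall>a\<in>carrier A. \<forall>a'\<in>carrier A. a \<otimes>\<^bsub>A\<^esub> a' = \<ominus>\<^bsub>A\<^esub> (a' \<otimes>\<^bsub>A\<^esub> a))"

definition Ann :: "('a, 'm) ring_scheme \<Rightarrow> 'a set"
  where "Ann A = {z \<in> carrier A. \<forall>a\<in>carrier A. a \<otimes>\<^bsub>A\<^esub> z = \<zero>\<^bsub>A\<^esub> \<and> z \<otimes>\<^bsub>A\<^esub> a = \<zero>\<^bsub>A\<^esub>}"

text \<open>
  In the next locale \<open>b \<triangleright> a\<close> is the left action \<open>ba\<close> and \<open>a \<triangleleft> b\<close> the right action \<open>ab\<close>.
  Operations without a subscript are those of \<open>A\<close>.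
\<close>

locale derived_action =
  A: g_alternative_algebra F A + B: g_alternative_algebra F B
  for F :: "('k, 'f) ring_scheme" and A :: "('k, 'a, 'm) module_scheme" (structure)
    and B :: "('k, 'b, 'n) module_scheme" +
  fixes lact :: "'b \<Rightarrow> 'a \<Rightarrow> 'a" (infixl "\<triangleright>" 70)
    and ract :: "'a \<Rightarrow> 'b \<Rightarrow> 'a" (infixl "\<triangleleft>" 70)
  assumes lact_bilinear: "(\<triangleright>) \<in> bilinear_maps F B A A"
    and ract_bilinear: "(\<triangleleft>) \<in> bilinear_maps F A B A"
    and action_1: "\<lbrakk>b \<in> carrier B; a1 \<in> carrier A; a2 \<in> carrier A\<rbrakk> \<Longrightarrow>
      b \<triangleright> (a1 \<otimes> a2) = (b \<triangleright> a1) \<otimes> a2 \<oplus> (a1 \<triangleleft> b) \<otimes> a2 \<ominus> a1 \<otimes> (b \<triangleright> a2)"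
    and action_2: "\<lbrakk>b \<in> carrier B; a1 \<in> carrier A; a2 \<in> carrier A\<rbrakk> \<Longrightarrow>
      (a1 \<otimes> a2) \<triangleleft> b = a1 \<otimes> (a2 \<triangleleft> b) \<oplus> a1 \<otimes> (b \<triangleright> a2) \<ominus> (a1 \<triangleleft> b) \<otimes> a2"
    and action_3: "\<lbrakk>b \<in> carrier B; a1 \<in> carrier A; a2 \<in> carrier A\<rbrakk> \<Longrightarrow>
      (b \<triangleright> a1) \<otimes> a2 = b \<triangleright> (a1 \<otimes> a2) \<oplus> b \<triangleright> (a2 \<otimes> a1) \<ominus> (b \<triangleright> a2) \<otimes> a1"
    and action_4: "\<lbrakk>b \<in> carrier B; a1 \<in> carrier A; a2 \<in> carrier A\<rbrakk> \<Longrightarrow>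
      a1 \<otimes> (a2 \<triangleleft> b) = (a1 \<otimes> a2) \<triangleleft> b \<oplus> (a2 \<otimes> a1) \<triangleleft> b \<ominus> a2 \<otimes> (a1 \<triangleleft> b)"
    and action_5: "\<lbrakk>b1 \<in> carrier B; b2 \<in> carrier B; a \<in> carrier A\<rbrakk> \<Longrightarrow>
      (b1 \<otimes>\<^bsub>B\<^esub> b2) \<triangleright> a = b1 \<triangleright> (b2 \<triangleright> a) \<oplus> b1 \<triangleright> (a \<triangleleft> b2) \<ominus> (b1 \<triangleright> a) \<triangleleft> b2"
    and action_6: "\<lbrakk>b1 \<in> carrier B; b2 \<in> carrier B; a \<in> carrier A\<rbrakk> \<Longrightarrow>
      a \<triangleleft> (b1 \<otimes>\<^bsub>B\<^esub> b2) = (a \<triangleleft> b1) \<triangleleft> b2 \<oplus> (b1 \<triangleright> a) \<triangleleft> b2 \<ominus> b1 \<triangleright> (a \<triangleleft> b2)"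
    and action_7: "\<lbrakk>b1 \<in> carrier B; b2 \<in> carrier B; a \<in> carrier A\<rbrakk> \<Longrightarrow>
      (a \<triangleleft> b1) \<triangleleft> b2 = a \<triangleleft> (b1 \<otimes>\<^bsub>B\<^esub> b2) \<oplus> a \<triangleleft> (b2 \<otimes>\<^bsub>B\<^esub> b1) \<ominus> (a \<triangleleft> b2) \<triangleleft> b1"
    and action_8: "\<lbrakk>b1 \<in> carrier B; b2 \<in> carrier B; a \<in> carrier A\<rbrakk> \<Longrightarrow>
      b1 \<triangleright> (b2 \<triangleright> a) = (b1 \<otimes>\<^bsub>B\<^esub> b2) \<triangleright> a \<oplus> (b2 \<otimes>\<^bsub>B\<^esub> b1) \<triangleright> a \<ominus> b2 \<triangleright> (b1 \<triangleright> a)"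

text \<open>
  The universal property quantifies over all test algebras \<open>C\<close> whose elements have type \<open>'c\<close>.
  HOL cannot quantify over types inside a formula, so \<open>'c\<close> is a parameter; a theorem about
  \<open>is_actor TYPE('c)\<close> with \<open>'c\<close> a free type variable holds for test algebras over every type.
  Homomorphisms are made extensional so that uniqueness means uniqueness on the carrier.
\<close>

definition is_actor ::
  "'c itself \<Rightarrow> ('k, 'f) ring_scheme \<Rightarrow> ('k, 'a, 'm) module_scheme \<Rightarrow> ('k, 'b, 'n) module_scheme \<Rightarrow>
    ('b \<Rightarrow> 'a \<Rightarrow> 'a) \<Rightarrow> ('a \<Rightarrow> 'b \<Rightarrow> 'a) \<Rightarrow> bool"
  where "is_actor _ F A B lact ract \<longleftrightarrow>
    derived_action F A B lact ract \<and>
    (\<forall>(C :: ('k, 'c) module) lactC ractC. derived_action F A C lactC ractC \<longrightarrow>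
      (\<exists>!\<phi>. \<phi> \<in> extensional (carrier C) \<and> \<phi> \<in> algebra_homs F C B \<and>
        (\<forall>c\<in>carrier C. \<forall>a\<in>carrier A. lactC c a = lact (\<phi> c) a \<and> ractC a c = ract a (\<phi> c))))"

text \<open>
  A pair \<open>f = (l, r)\<close> has \<open>fa = l a\<close> and \<open>af = r a\<close>. All maps are extensional on the carrier of
  \<open>A\<close>, so that pairs giving the same maps on \<open>A\<close> are equal.
\<close>

definition bim_generators ::
  "('k, 'f) ring_scheme \<Rightarrow> ('k, 'a, 'm) module_scheme \<Rightarrow> (('a \<Rightarrow> 'a) \<times> ('a \<Rightarrow> 'a)) set"
  where "bim_generators F A = {(l, r).
    l \<in> linear_maps F A A \<and> r \<in> linear_maps F A A \<and>
    l \<in> extensional (carrier A) \<and> r \<in> extensional (carrier A) \<and>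
    (\<forall>a1\<in>carrier A. \<forall>a2\<in>carrier A.
      l (a1 \<otimes>\<^bsub>A\<^esub> a2) = l a1 \<otimes>\<^bsub>A\<^esub> a2 \<oplus>\<^bsub>A\<^esub> r a1 \<otimes>\<^bsub>A\<^esub> a2 \<ominus>\<^bsub>A\<^esub> a1 \<otimes>\<^bsub>A\<^esub> l a2 \<and>
      r (a1 \<otimes>\<^bsub>A\<^esub> a2) = a1 \<otimes>\<^bsub>A\<^esub> r a2 \<oplus>\<^bsub>A\<^esub> a1 \<otimes>\<^bsub>A\<^esub> l a2 \<ominus>\<^bsub>A\<^esub> r a1 \<otimes>\<^bsub>A\<^esub> a2 \<and>
      l a1 \<otimes>\<^bsub>A\<^esub> a2 = l (a1 \<otimes>\<^bsub>A\<^esub> a2) \<oplus>\<^bsub>A\<^esub> l (a2 \<otimes>\<^bsub>A\<^esub> a1) \<ominus>\<^bsub>A\<^esub> l a2 \<otimes>\<^bsub>A\<^esub> a1 \<and>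
      a1 \<otimes>\<^bsub>A\<^esub> r a2 = r (a1 \<otimes>\<^bsub>A\<^esub> a2) \<oplus>\<^bsub>A\<^esub> r (a2 \<otimes>\<^bsub>A\<^esub> a1) \<ominus>\<^bsub>A\<^esub> a2 \<otimes>\<^bsub>A\<^esub> r a1)}"

definition bim_add ::
  "('k, 'a, 'm) module_scheme \<Rightarrow> ('a \<Rightarrow> 'a) \<times> ('a \<Rightarrow> 'a) \<Rightarrow> ('a \<Rightarrow> 'a) \<times> ('a \<Rightarrow> 'a) \<Rightarrow>
    ('a \<Rightarrow> 'a) \<times> ('a \<Rightarrow> 'a)"
  where "bim_add A = (\<lambda>(l, r) (l', r').
    (\<lambda>a\<in>carrier A. l a \<oplus>\<^bsub>A\<^esub> l' a, \<lambda>a\<in>carrier A. r a \<oplus>\<^bsub>A\<^esub> r' a))"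

text \<open>
  \<open>(ff')a = f(f'a) + f(af') - (fa)f'\<close> and \<open>a(ff') = (af)f' + (fa)f' - f(af')\<close>.
\<close>

definition bim_mult ::
  "('k, 'a, 'm) module_scheme \<Rightarrow> ('a \<Rightarrow> 'a) \<times> ('a \<Rightarrow> 'a) \<Rightarrow> ('a \<Rightarrow> 'a) \<times> ('a \<Rightarrow> 'a) \<Rightarrow>
    ('a \<Rightarrow> 'a) \<times> ('a \<Rightarrow> 'a)"
  where "bim_mult A = (\<lambda>(l, r) (l', r').
    (\<lambda>a\<in>carrier A. l (l' a) \<oplus>\<^bsub>A\<^esub> l (r' a) \<ominus>\<^bsub>A\<^esub> r' (l a),
     \<lambda>a\<in>carrier A. r' (r a) \<oplus>\<^bsub>A\<^esub> r' (l a) \<ominus>\<^bsub>A\<^esub> l (r' a)))"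

inductive_set bim_carrier ::
  "('k, 'f) ring_scheme \<Rightarrow> ('k, 'a, 'm) module_scheme \<Rightarrow> (('a \<Rightarrow> 'a) \<times> ('a \<Rightarrow> 'a)) set"
  for F :: "('k, 'f) ring_scheme" and A :: "('k, 'a, 'm) module_scheme"
  where
    generator: "f \<in> bim_generators F A \<Longrightarrow> f \<in> bim_carrier F A"
  | add: "\<lbrakk>f \<in> bim_carrier F A; f' \<in> bim_carrier F A\<rbrakk> \<Longrightarrow> bim_add A f f' \<in> bim_carrier F A"
  | mult: "\<lbrakk>f \<in> bim_carrier F A; f' \<in> bim_carrier F A\<rbrakk> \<Longrightarrow> bim_mult A f f' \<in> bim_carrier F A"

definition Bim_gAlt ::
  "('k, 'f) ring_scheme \<Rightarrow> ('k, 'a, 'm) module_scheme \<Rightarrow>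
    ('k, ('a \<Rightarrow> 'a) \<times> ('a \<Rightarrow> 'a)) module"
  where "Bim_gAlt F A =
    \<lparr>carrier = bim_carrier F A,
     mult = bim_mult A,
     one = undefined,
     zero = (\<lambda>a\<in>carrier A. \<zero>\<^bsub>A\<^esub>, \<lambda>a\<in>carrier A. \<zero>\<^bsub>A\<^esub>),
     add = bim_add A,
     smult = (\<lambda>c (l, r). (\<lambda>a\<in>carrier A. c \<odot>\<^bsub>A\<^esub> l a, \<lambda>a\<in>carrier A. c \<odot>\<^bsub>A\<^esub> r a))\<rparr>"

definition bim_lact :: "('a \<Rightarrow> 'a) \<times> ('a \<Rightarrow> 'a) \<Rightarrow> 'a \<Rightarrow> 'a"
  where "bim_lact f a = fst f a"

definition bim_ract :: "'a \<Rightarrow> ('a \<Rightarrow> 'a) \<times> ('a \<Rightarrow> 'a) \<Rightarrow> 'a"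
  where "bim_ract a f = snd f a"

end

theory Submission
  imports Defs
begin

text \<open>
  In an anticommutative g-alternative algebra \<open>x(yz)\<close> is skew-symmetric in all three arguments, and
  the four defining conditions on a pair \<open>(l, r)\<close> become \<open>l(ab) = r(a)b = a r(b)\<close> and
  \<open>r(ab) = l(a)b = a l(b)\<close>. Moving \<open>l\<close> and \<open>r\<close> around in a product of three elements gives
  \<open>l(a)(bc) = r(a)(bc)\<close>, and a vanishing annihilator then forces \<open>l = r\<close>. Hence the generating pairs
  are the pairs \<open>(f, f)\<close> with \<open>f\<close> in the centroid of \<open>A\<close>. As the annihilator vanishes, the centroid
  is commutative; therefore the product of pairs is composition, the generators are already closed
  under the operations, and they form a commutative associative algebra, which is g-alternative. Every
  element of an algebra acting on \<open>A\<close> gives a generating pair, and this yields the universal map.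
\<close>

section \<open>The centroid and access rules for linear maps\<close>

definition centroid ::
  "('k, 'f) ring_scheme \<Rightarrow> ('k, 'a, 'm) module_scheme \<Rightarrow> ('a \<Rightarrow> 'a) set"
  where "centroid F A = {f \<in> linear_maps F A A. f \<in> extensional (carrier A) \<and>
    (\<forall>a\<in>carrier A. \<forall>b\<in>carrier A.
      f a \<otimes>\<^bsub>A\<^esub> b = f (a \<otimes>\<^bsub>A\<^esub> b) \<and> a \<otimes>\<^bsub>A\<^esub> f b = f (a \<otimes>\<^bsub>A\<^esub> b))}"

lemma linear_mapsD:
  assumes "g \<in> linear_maps F U V"
  shows "\<And>x. x \<in> carrier U \<Longrightarrow> g x \<in> carrier V"
    and "\<And>x y. \<lbrakk>x \<in> carrier U; y \<in> carrier U\<rbrakk> \<Longrightarrow> g (x \<oplus>\<^bsub>U\<^esub> y) = g x \<oplus>\<^bsub>V\<^esub> g y"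
    and "\<And>c x. \<lbrakk>c \<in> carrier F; x \<in> carrier U\<rbrakk> \<Longrightarrow> g (c \<odot>\<^bsub>U\<^esub> x) = c \<odot>\<^bsub>V\<^esub> g x"
  using assms by (auto simp: linear_maps_def)

lemma bilinear_mapsD:
  assumes "g \<in> bilinear_maps F U V W"
  shows "x \<in> carrier U \<Longrightarrow> g x \<in> linear_maps F V W"
    and "y \<in> carrier V \<Longrightarrow> (\<lambda>x. g x y) \<in> linear_maps F U W"
  using assms by (auto simp: bilinear_maps_def)

lemma centroidD:
  assumes "f \<in> centroid F A"
  shows "f \<in> linear_maps F A A" and "f \<in> extensional (carrier A)"
    and "\<And>a b. \<lbrakk>a \<in> carrier A; b \<in> carrier A\<rbrakk> \<Longrightarrow> f a \<otimes>\<^bsub>A\<^esub> b = f (a \<otimes>\<^bsub>A\<^esub> b)"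
    and "\<And>a b. \<lbrakk>a \<in> carrier A; b \<in> carrier A\<rbrakk> \<Longrightarrow> a \<otimes>\<^bsub>A\<^esub> f b = f (a \<otimes>\<^bsub>A\<^esub> b)"
  using assms by (auto simp: centroid_def)

lemmas centroid_linear = linear_mapsD[OF centroidD(1)]

section \<open>Arithmetic of a bilinear product and closure properties of the centroid\<close>

context nonassoc_algebra
begin

lemma mult_closed [simp]: "\<lbrakk>x \<in> carrier A; y \<in> carrier A\<rbrakk> \<Longrightarrow> x \<otimes> y \<in> carrier A"
  by (rule linear_mapsD(1)[OF bilinear_mapsD(1)[OF mult_bilinear]])

lemma mult_add_right:
  "\<lbrakk>x \<in> carrier A; y \<in> carrier A; z \<in> carrier A\<rbrakk> \<Longrightarrow> x \<otimes> (y \<oplus> z) = x \<otimes> y \<oplus> x \<otimes> z"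
  by (rule linear_mapsD(2)[OF bilinear_mapsD(1)[OF mult_bilinear]])

lemma mult_add_left:
  "\<lbrakk>x \<in> carrier A; y \<in> carrier A; z \<in> carrier A\<rbrakk> \<Longrightarrow> (x \<oplus> y) \<otimes> z = x \<otimes> z \<oplus> y \<otimes> z"
  using linear_mapsD(2)[OF bilinear_mapsD(2)[OF mult_bilinear]] by simp

lemma mult_smult_right:
  "\<lbrakk>c \<in> carrier F; x \<in> carrier A; y \<in> carrier A\<rbrakk> \<Longrightarrow> x \<otimes> (c \<odot> y) = c \<odot> (x \<otimes> y)"
  by (rule linear_mapsD(3)[OF bilinear_mapsD(1)[OF mult_bilinear]])

lemma mult_smult_left:
  "\<lbrakk>c \<in> carrier F; x \<in> carrier A; y \<in> carrier A\<rbrakk> \<Longrightarrow> (c \<odot> x) \<otimes> y = c \<odot> (x \<otimes> y)"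
  using linear_mapsD(3)[OF bilinear_mapsD(2)[OF mult_bilinear]] by simp

text \<open>Phrased for an arbitrary additive self-map, so that it covers left and right
  multiplication by a fixed element as well as the maps of a generating pair.\<close>

lemma additive_zero:
  assumes g: "\<And>x. x \<in> carrier A \<Longrightarrow> g x \<in> carrier A"
    and add: "\<And>x y. \<lbrakk>x \<in> carrier A; y \<in> carrier A\<rbrakk> \<Longrightarrow> g (x \<oplus> y) = g x \<oplus> g y"
  shows "g \<zero> = \<zero>"
  by (metis M.add.r_cancel_one M.add.r_one M.zero_closed g add)

lemma additive_minus:
  assumes g: "\<And>x. x \<in> carrier A \<Longrightarrow> g x \<in> carrier A"
    and add: "\<And>x y. \<lbrakk>x \<in> carrier A; y \<in> carrier A\<rbrakk> \<Longrightarrow> g (x \<oplus> y) = g x \<oplus> g y"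
    and x: "x \<in> carrier A"
  shows "g (\<ominus> x) = \<ominus> g x"
  by (metis M.add.inv_closed M.add.inv_equality M.l_neg additive_zero[of g] g add x)

lemma mult_zero_right [simp]: "x \<in> carrier A \<Longrightarrow> x \<otimes> \<zero> = \<zero>"
  by (rule additive_zero) (auto simp: mult_add_right)

lemma mult_zero_left [simp]: "x \<in> carrier A \<Longrightarrow> \<zero> \<otimes> x = \<zero>"
  by (rule additive_zero[of "\<lambda>y. y \<otimes> x"]) (auto simp: mult_add_left)

lemma mult_minus_left: "\<lbrakk>x \<in> carrier A; y \<in> carrier A\<rbrakk> \<Longrightarrow> (\<ominus> x) \<otimes> y = \<ominus> (x \<otimes> y)"
  by (rule additive_minus[of "\<lambda>x. x \<otimes> y"]) (auto simp: mult_add_left)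

lemma add_minus_cancel_right:
  "\<lbrakk>x \<in> carrier A; y \<in> carrier A\<rbrakk> \<Longrightarrow> (x \<oplus> y) \<ominus> y = x"
  by (simp add: a_minus_def M.add.m_assoc M.r_neg)

lemma add_minus_cancel_left:
  "\<lbrakk>x \<in> carrier A; y \<in> carrier A\<rbrakk> \<Longrightarrow> (x \<oplus> y) \<ominus> x = y"
  by (metis M.a_comm add_minus_cancel_right)

lemma eq_if_minus_zero: "\<lbrakk>x \<in> carrier A; y \<in> carrier A; x \<ominus> y = \<zero>\<rbrakk> \<Longrightarrow> x = y"
  by (metis M.minus_minus M.minus_equality M.add.inv_closed a_minus_def)

lemma centroid_zero: "(\<lambda>a\<in>carrier A. \<zero>) \<in> centroid F A"
  by (auto simp: centroid_def linear_maps_def)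

lemma centroid_add:
  "\<lbrakk>f \<in> centroid F A; g \<in> centroid F A\<rbrakk> \<Longrightarrow> (\<lambda>a\<in>carrier A. f a \<oplus> g a) \<in> centroid F A"
  by (auto simp: centroid_def linear_maps_def mult_add_left mult_add_right M.a_ac smult_r_distr
      Pi_iff)

text \<open>Commutativity of \<open>F\<close> (\<open>m_comm\<close>) is what lets the scaled map
  commute with the other scalars.\<close>

lemma centroid_smult:
  "\<lbrakk>c \<in> carrier F; f \<in> centroid F A\<rbrakk> \<Longrightarrow> (\<lambda>a\<in>carrier A. c \<odot> f a) \<in> centroid F A"
  by (auto simp: centroid_def linear_maps_def mult_smult_left mult_smult_right smult_r_distr
      Pi_iff smult_assoc1[symmetric] m_comm)

lemma centroid_compose:
  "\<lbrakk>f \<in> centroid F A; g \<in> centroid F A\<rbrakk> \<Longrightarrow> compose (carrier A) f g \<in> centroid F A"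
  by (auto simp: centroid_def linear_maps_def compose_def Pi_iff)

end

section \<open>Skew-symmetry of triple products and tests for zero\<close>

locale anticommutative_g_alternative_algebra = g_alternative_algebra +
  assumes anticommutative: "anticommutative A"
    and Ann_trivial: "Ann A = {\<zero>}"
begin

lemma mult_anticomm: "\<lbrakk>x \<in> carrier A; y \<in> carrier A\<rbrakk> \<Longrightarrow> x \<otimes> y = \<ominus> (y \<otimes> x)"
  using anticommutative unfolding anticommutative_def by blast

lemma mult_add_flip: "\<lbrakk>x \<in> carrier A; y \<in> carrier A\<rbrakk> \<Longrightarrow> x \<otimes> y \<oplus> y \<otimes> x = \<zero>"
  by (simp add: mult_anticomm[of x y] M.l_neg)

text \<open>The first two terms of the left law combine to (xy + yx)z, which anticommutativity makes
  zero. Together with yz = -zy this gives skew-symmetry in all three arguments.\<close>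

lemma triple_swap:
  assumes "x \<in> carrier A" "y \<in> carrier A" "z \<in> carrier A"
  shows "x \<otimes> (y \<otimes> z) = \<ominus> (y \<otimes> (x \<otimes> z))"
proof -
  have "x \<otimes> (y \<otimes> z) = (x \<otimes> y) \<otimes> z \<oplus> (y \<otimes> x) \<otimes> z \<ominus> y \<otimes> (x \<otimes> z)"
    using assms by (rule g_alt_left)
  also have "(x \<otimes> y) \<otimes> z \<oplus> (y \<otimes> x) \<otimes> z = \<zero>"
    using assms mult_add_left[of "x \<otimes> y" "y \<otimes> x" z] by (simp add: mult_add_flip)
  finally show ?thesis
    using assms by (simp add: a_minus_def)
qed

lemma zero_if_annihilates:
  assumes x: "x \<in> carrier A" and ann: "\<And>b. b \<in> carrier A \<Longrightarrow> x \<otimes> b = \<zero>"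
  shows "x = \<zero>"
proof -
  have "x \<in> Ann A"
    using x ann by (auto simp: Ann_def mult_anticomm[of _ x])
  with Ann_trivial show ?thesis by simp
qed

text \<open>The annihilator is used twice: xc is tested against b, and skew-symmetry turns b(xc)
  into -x(bc). This matters because the comparison of \<open>l\<close> and \<open>r\<close> below
  only reaches products bc.\<close>

lemma zero_if_annihilates_products:
  assumes x: "x \<in> carrier A"
    and ann: "\<And>b c. \<lbrakk>b \<in> carrier A; c \<in> carrier A\<rbrakk> \<Longrightarrow> x \<otimes> (b \<otimes> c) = \<zero>"
  shows "x = \<zero>"
proof (rule zero_if_annihilates[OF x])
  fix c assume c: "c \<in> carrier A"
  show "x \<otimes> c = \<zero>"
  proof (rule zero_if_annihilates)
    fix b assume b: "b \<in> carrier A"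
    have "b \<otimes> (x \<otimes> c) = \<zero>"
      using triple_swap[OF b x c] ann[OF b c] by simp
    then show "(x \<otimes> c) \<otimes> b = \<zero>"
      using x b c by (simp add: mult_anticomm[of _ b])
  qed (use x c in simp)
qed

section \<open>Generating pairs and the centroid\<close>

lemma bim_generator_centroid:
  assumes "(l, r) \<in> bim_generators F A"
  shows "l = r" and "l \<in> centroid F A"
proof -
  have lin: "l \<in> linear_maps F A A" "r \<in> linear_maps F A A"
    and ext: "l \<in> extensional (carrier A)" "r \<in> extensional (carrier A)"
    using assms by (auto simp: bim_generators_def)
  note cl [simp] = linear_mapsD(1)[OF lin(1)] linear_mapsD(1)[OF lin(2)]
  have eq: "l (a \<otimes> b) = l a \<otimes> b \<oplus> r a \<otimes> b \<ominus> a \<otimes> l b"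
      "r (a \<otimes> b) = a \<otimes> r b \<oplus> a \<otimes> l b \<ominus> r a \<otimes> b"
      "l a \<otimes> b = l (a \<otimes> b) \<oplus> l (b \<otimes> a) \<ominus> l b \<otimes> a"
      "a \<otimes> r b = r (a \<otimes> b) \<oplus> r (b \<otimes> a) \<ominus> b \<otimes> r a"
    if "a \<in> carrier A" "b \<in> carrier A" for a b
    using assms that unfolding bim_generators_def by blast+
  \<comment> \<open>The sums in the third and fourth conditions are \<open>g\<close> applied to ab +
    ba = 0, so these conditions reduce to the two rules \<open>l_move\<close> and
    \<open>r_move\<close>.\<close>
  have flip: "g (a \<otimes> b) \<oplus> g (b \<otimes> a) = \<zero>"
    if "g \<in> linear_maps F A A" "a \<in> carrier A" "b \<in> carrier A" for g a b
  proof -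
    have "g (a \<otimes> b) \<oplus> g (b \<otimes> a) = g (a \<otimes> b \<oplus> b \<otimes> a)"
      using that by (simp add: linear_mapsD(2)[OF that(1)])
    also have "\<dots> = g \<zero>"
      using that by (simp add: mult_add_flip)
    also have "\<dots> = \<zero>"
      by (rule additive_zero) (simp_all add: linear_mapsD[OF that(1)])
    finally show ?thesis .
  qed
  have l_move: "l a \<otimes> b = a \<otimes> l b" if "a \<in> carrier A" "b \<in> carrier A" for a b
    using eq(3)[OF that] that
    by (simp add: flip[OF lin(1)] a_minus_def mult_anticomm[of a "l b"])
  have r_move: "a \<otimes> r b = r a \<otimes> b" if "a \<in> carrier A" "b \<in> carrier A" for a b
    using eq(4)[OF that] that
    by (simp add: flip[OF lin(2)] a_minus_def mult_anticomm[of "r a" b])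
  \<comment> \<open>Moving \<open>l\<close> across the product cancels the outer terms of the first
    condition; only the term with \<open>r\<close> survives. The second condition likewise leaves
    only the term with \<open>l\<close>.\<close>
  have l_mult: "l (a \<otimes> b) = a \<otimes> r b" if "a \<in> carrier A" "b \<in> carrier A" for a b
    using eq(1)[OF that] that by (simp add: l_move r_move add_minus_cancel_left)
  have r_mult: "r (a \<otimes> b) = a \<otimes> l b" if "a \<in> carrier A" "b \<in> carrier A" for a b
    using eq(2)[OF that] that by (simp add: r_move add_minus_cancel_left)
  have same: "l a = r a" if a: "a \<in> carrier A" for a
  proof (rule eq_if_minus_zero)
    show "l a \<ominus> r a = \<zero>"
    proof (rule zero_if_annihilates_products)
      fix b c assume b: "b \<in> carrier A" and c: "c \<in> carrier A"
      \<comment> \<open>The map travels from a around the product and back. Each use of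
        \<open>l_mult\<close> or \<open>r_mult\<close> exchanges \<open>l\<close> and
        \<open>r\<close>, which happens three times, so it returns as \<open>r\<close>; the signs of
        the two swaps cancel.\<close>
      have "l a \<otimes> (b \<otimes> c) = a \<otimes> l (b \<otimes> c)"
        using a b c by (simp add: l_move)
      also have "\<dots> = a \<otimes> (b \<otimes> r c)"
        using b c by (simp add: l_mult)
      also have "\<dots> = \<ominus> (b \<otimes> (a \<otimes> r c))"
        using a b c by (simp add: triple_swap[of a b "r c"])
      also have "\<dots> = \<ominus> (b \<otimes> l (a \<otimes> c))"
        using a c by (simp add: l_mult)
      also have "\<dots> = \<ominus> (l b \<otimes> (a \<otimes> c))"
        using a b c by (simp add: l_move)
      also have "\<dots> = a \<otimes> (l b \<otimes> c)"
        using a b c by (simp add: triple_swap[of a "l b" c])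
      also have "\<dots> = a \<otimes> r (b \<otimes> c)"
        using b c by (simp add: l_move r_mult)
      also have "\<dots> = r a \<otimes> (b \<otimes> c)"
        using a b c by (simp add: r_move)
      finally show "(l a \<ominus> r a) \<otimes> (b \<otimes> c) = \<zero>"
        using a b c by (simp add: a_minus_def mult_add_left mult_minus_left M.r_neg)
    qed (use a in simp)
  qed (use a in simp_all)
  show lr: "l = r"
    by (rule extensionalityI[OF ext]) (rule same)
  have "l a \<otimes> b = l (a \<otimes> b) \<and> a \<otimes> l b = l (a \<otimes> b)"
    if "a \<in> carrier A" "b \<in> carrier A" for a b
    using l_mult[OF that] l_move[OF that] by (simp add: lr)
  with lin ext show "l \<in> centroid F A"
    by (simp add: centroid_def)
qed

text \<open>For l = r = f every product in the four conditions becomes f(ab) or f(ba), and two of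
  the three terms on the right cancel.\<close>

lemma centroid_bim_generator:
  assumes f: "f \<in> centroid F A"
  shows "(f, f) \<in> bim_generators F A"
proof -
  note cl [simp] = centroid_linear(1)[OF f]
  show ?thesis
    using centroidD(1,2)[OF f]
    by (auto simp: bim_generators_def centroidD(3,4)[OF f] add_minus_cancel_left add_minus_cancel_right)
qed

lemma bim_generators_eq: "bim_generators F A = (\<lambda>f. (f, f)) ` centroid F A"
  using bim_generator_centroid centroid_bim_generator by fast

text \<open>In a product with a test element b, \<open>f\<close> can step aside to the factor b
  while \<open>g\<close> is pulled out, and then return inside \<open>g\<close>. The zero
  annihilator removes b.\<close>

lemma centroid_commute:
  assumes f: "f \<in> centroid F A" and g: "g \<in> centroid F A" and a: "a \<in> carrier A"
  shows "f (g a) = g (f a)"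
proof (rule eq_if_minus_zero)
  show "f (g a) \<ominus> g (f a) = \<zero>"
  proof (rule zero_if_annihilates)
    fix b assume b: "b \<in> carrier A"
    have "f (g a) \<otimes> b = g a \<otimes> f b"
      using a b by (simp add: centroidD(3,4)[OF f] centroid_linear(1)[OF g])
    also have "\<dots> = g (a \<otimes> f b)"
      using a b by (simp add: centroidD(3)[OF g] centroid_linear(1)[OF f])
    also have "\<dots> = g (f a) \<otimes> b"
      using a b by (simp add: centroidD(3,4)[OF f] centroidD(3)[OF g] centroid_linear(1)[OF f])
    finally show "(f (g a) \<ominus> g (f a)) \<otimes> b = \<zero>"
      using a b centroid_linear(1)[OF f] centroid_linear(1)[OF g]
      by (simp add: a_minus_def mult_add_left mult_minus_left M.r_neg)
  qed (use a centroid_linear(1)[OF f] centroid_linear(1)[OF g] in simp)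
qed (use a centroid_linear(1)[OF f] centroid_linear(1)[OF g] in simp_all)

text \<open>Each component has the form x + x - y, where x and y are the composites in the two
  orders; these agree by \<open>centroid_commute\<close>.\<close>

lemma bim_mult_diag:
  assumes "f \<in> centroid F A" and "g \<in> centroid F A"
  shows "bim_mult A (f, f) (g, g) = (compose (carrier A) f g, compose (carrier A) f g)"
  using assms centroid_linear(1)[OF assms(1)] centroid_linear(1)[OF assms(2)]
  by (auto simp: bim_mult_def compose_def centroid_commute[of f g] add_minus_cancel_left
      intro!: restrict_ext)

lemma bim_carrier_eq: "bim_carrier F A = (\<lambda>f. (f, f)) ` centroid F A"
proof
  show "bim_carrier F A \<subseteq> (\<lambda>f. (f, f)) ` centroid F A"
  proof
    fix p assume "p \<in> bim_carrier F A"
    then show "p \<in> (\<lambda>f. (f, f)) ` centroid F A"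
    proof induction
      case (generator p)
      then show ?case by (simp add: bim_generators_eq)
    next
      case (add p q)
      then show ?case by (auto simp: bim_add_def centroid_add)
    next
      case (mult p q)
      then show ?case by (auto simp: bim_mult_diag centroid_compose)
    qed
  qed
  show "(\<lambda>f. (f, f)) ` centroid F A \<subseteq> bim_carrier F A"
    using bim_generators_eq bim_carrier.generator by blast
qed

section \<open>The algebra structure on the diagonal pairs\<close>

lemma Bim_sel:
  "carrier (Bim_gAlt F A) = (\<lambda>f. (f, f)) ` centroid F A"
  "mult (Bim_gAlt F A) = bim_mult A"
  "add (Bim_gAlt F A) = bim_add A"
  "zero (Bim_gAlt F A) = (\<lambda>a\<in>carrier A. \<zero>, \<lambda>a\<in>carrier A. \<zero>)"
  "smult (Bim_gAlt F A) =
    (\<lambda>c (l, r). (\<lambda>a\<in>carrier A. c \<odot> l a, \<lambda>a\<in>carrier A. c \<odot> r a))"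
  by (simp_all add: Bim_gAlt_def bim_carrier_eq)

lemma Bim_abelian_group: "abelian_group (Bim_gAlt F A)"
proof (rule abelian_groupI, goal_cases)
  case (1 x y)
  then show ?case by (auto simp: Bim_sel bim_add_def centroid_add)
next
  case 2
  then show ?case by (simp add: Bim_sel centroid_zero)
next
  case (3 x y z)
  then show ?case
    by (auto simp: Bim_sel bim_add_def centroid_linear(1) M.a_assoc intro!: restrict_ext)
next
  case (4 x y)
  then show ?case
    by (auto simp: Bim_sel bim_add_def centroid_linear(1) M.a_comm intro!: restrict_ext)
next
  \<comment> \<open>The right-hand side is the bare pair rather than a restriction, so equality off
    the carrier rests on centroid maps being extensional.\<close>
  case (5 x)
  then show ?case
    by (auto simp: Bim_sel bim_add_def centroid_linear(1) centroidD(2)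
        intro!: extensionalityI[where A = "carrier A"])
next
  case (6 x)
  then obtain f where f: "f \<in> centroid F A" "x = (f, f)" by (auto simp: Bim_sel)
  \<comment> \<open>The additive inverse is taken as the multiple by -1, so that its membership is
    an instance of \<open>centroid_smult\<close>.\<close>
  let ?g = "\<lambda>a\<in>carrier A. (\<ominus>\<^bsub>F\<^esub> \<one>\<^bsub>F\<^esub>) \<odot> f a"
  have "?g \<in> centroid F A"
    by (rule centroid_smult) (use f in auto)
  moreover have "bim_add A (?g, ?g) (f, f) = (\<lambda>a\<in>carrier A. \<zero>, \<lambda>a\<in>carrier A. \<zero>)"
    using centroid_linear(1)[OF f(1)]
    by (auto simp: bim_add_def smult_l_minus M.l_neg intro!: restrict_ext)
  ultimately show ?case
    by (auto simp: Bim_sel f(2) intro!: bexI[of _ ?g])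
qed

lemma Bim_module: "module F (Bim_gAlt F A)"
proof (rule moduleI, goal_cases)
  case 1
  show ?case by unfold_locales
next
  case 2
  show ?case by (rule Bim_abelian_group)
next
  case (3 c x)
  then show ?case by (auto simp: Bim_sel centroid_smult)
next
  case (4 c d x)
  then show ?case
    by (auto simp: Bim_sel bim_add_def centroid_linear(1) smult_l_distr intro!: restrict_ext)
next
  case (5 c x y)
  then show ?case
    by (auto simp: Bim_sel bim_add_def centroid_linear(1) smult_r_distr intro!: restrict_ext)
next
  case (6 c d x)
  then show ?case
    by (auto simp: Bim_sel centroid_linear(1) smult_assoc1 intro!: restrict_ext)
next
  case (7 x)
  then show ?case
    by (auto simp: Bim_sel centroid_linear(1) centroidD(2)
        intro!: extensionalityI[where A = "carrier A"])
qed

lemma Bim_mult_bilinear: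
  "mult (Bim_gAlt F A) \<in> bilinear_maps F (Bim_gAlt F A) (Bim_gAlt F A) (Bim_gAlt F A)"
  unfolding bilinear_maps_def linear_maps_def
  by (auto simp: Bim_sel bim_mult_diag centroid_compose[unfolded compose_def] bim_add_def
      centroid_add centroid_smult compose_def centroid_linear intro!: restrict_ext)

lemma Bim_nonassoc_algebra: "nonassoc_algebra F (Bim_gAlt F A)"
  by (intro nonassoc_algebra.intro nonassoc_algebra_axioms.intro Bim_module Bim_mult_bilinear
      field_axioms)

lemma Bim_mult_assoc:
  "\<lbrakk>x \<in> carrier (Bim_gAlt F A); y \<in> carrier (Bim_gAlt F A); z \<in> carrier (Bim_gAlt F A)\<rbrakk> \<Longrightarrow>
    (x \<otimes>\<^bsub>Bim_gAlt F A\<^esub> y) \<otimes>\<^bsub>Bim_gAlt F A\<^esub> z =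
    x \<otimes>\<^bsub>Bim_gAlt F A\<^esub> (y \<otimes>\<^bsub>Bim_gAlt F A\<^esub> z)"
  \<comment> \<open>\<open>compose\<close> stays folded at first, so that
    \<open>bim_mult_diag\<close> also applies to the nested products; it is unfolded
    afterwards.\<close>
  by (auto simp: Bim_sel bim_mult_diag centroid_compose)
    (auto simp: compose_def centroid_linear(1))

text \<open>By associativity the last two terms of each law cancel: (yx)z against y(xz), and x(zy)
  against (xz)y.\<close>

lemma Bim_g_alternative: "g_alternative_algebra F (Bim_gAlt F A)"
proof -
  interpret B: nonassoc_algebra F "Bim_gAlt F A" by (rule Bim_nonassoc_algebra)
  show ?thesis
  proof (unfold_locales, goal_cases)
    case (1 x y z)
    then show ?case
      by (simp add: Bim_mult_assoc B.add_minus_cancel_right)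
  next
    case (2 x y z)
    then show ?case
      by (simp add: Bim_mult_assoc B.add_minus_cancel_right)
  qed
qed

section \<open>The action on \<open>A\<close> and its universal property\<close>

lemma Bim_derived_action: "derived_action F A (Bim_gAlt F A) bim_lact bim_ract"
proof -
  interpret B: g_alternative_algebra F "Bim_gAlt F A" by (rule Bim_g_alternative)
  have bim: "bim_lact \<in> bilinear_maps F (Bim_gAlt F A) A A"
    "bim_ract \<in> bilinear_maps F A (Bim_gAlt F A) A"
    by (auto simp: bilinear_maps_def linear_maps_def bim_lact_def bim_ract_def Bim_sel
        bim_add_def centroid_linear)
  \<comment> \<open>A pair (f, f) acts as \<open>f\<close> on both sides. The first four axioms are
    then centroid identities, and the last four follow from commuting composites.\<close>
  show ?thesis
    by (unfold_locales, fact bim, fact bim)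
      (auto simp: Bim_sel bim_lact_def bim_ract_def bim_mult_diag compose_def centroid_linear(1)
        centroidD(3,4) add_minus_cancel_left add_minus_cancel_right centroid_commute)
qed

text \<open>An element c must go to the pair of maps by which it acts. Axioms 1 to 4 say that this
  pair is a generator; axioms 5 and 6 are the formula of \<open>bim_mult\<close> and give
  multiplicativity.\<close>

lemma Bim_universal:
  assumes "derived_action F A C lactC ractC"
  shows "\<exists>!\<phi>. \<phi> \<in> extensional (carrier C) \<and> \<phi> \<in> algebra_homs F C (Bim_gAlt F A) \<and>
    (\<forall>c\<in>carrier C. \<forall>a\<in>carrier A.
      lactC c a = bim_lact (\<phi> c) a \<and> ractC a c = bim_ract a (\<phi> c))"
proof -
  interpret C: derived_action F A C lactC ractC by (rule assms)
  note L = linear_mapsD[OF bilinear_mapsD(1)[OF C.lact_bilinear]]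
    linear_mapsD[OF bilinear_mapsD(2)[OF C.lact_bilinear]]
  note R = linear_mapsD[OF bilinear_mapsD(1)[OF C.ract_bilinear]]
    linear_mapsD[OF bilinear_mapsD(2)[OF C.ract_bilinear]]
  let ?p = "\<lambda>c. (\<lambda>a\<in>carrier A. lactC c a, \<lambda>a\<in>carrier A. ractC a c)"
  let ?\<phi> = "\<lambda>c\<in>carrier C. ?p c"
  have gen: "?p c \<in> bim_generators F A" if "c \<in> carrier C" for c
    unfolding bim_generators_def mem_Collect_eq prod.case
  proof (intro conjI ballI, goal_cases)
    case (5 a1 a2)
    with C.action_1[OF that this] show ?case by (simp add: that L R)
  next
    case (6 a1 a2)
    with C.action_2[OF that this] show ?case by (simp add: that L R)
  next
    case (7 a1 a2)
    with C.action_3[OF that this] show ?case by (simp add: that L R)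
  next
    case (8 a1 a2)
    with C.action_4[OF that this] show ?case by (simp add: that L R)
  qed (auto simp: linear_maps_def that L R)
  have carr: "?p c \<in> carrier (Bim_gAlt F A)" if "c \<in> carrier C" for c
    using gen[OF that] by (simp only: Bim_sel bim_generators_eq)
  \<comment> \<open>\<open>Bim_sel(1)\<close> is left out so that carrier membership stays in the
    form of \<open>carr\<close>.\<close>
  have hom: "?\<phi> \<in> algebra_homs F C (Bim_gAlt F A)"
    unfolding algebra_homs_def linear_maps_def
    by (auto simp: carr L R Bim_sel(2-5) bim_add_def bim_mult_def C.action_5 C.action_6
        intro!: restrict_ext)
  show ?thesis
  proof (rule ex1I[of _ ?\<phi>])
    show "?\<phi> \<in> extensional (carrier C) \<and> ?\<phi> \<in> algebra_homs F C (Bim_gAlt F A) \<and>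
      (\<forall>c\<in>carrier C. \<forall>a\<in>carrier A.
        lactC c a = bim_lact (?\<phi> c) a \<and> ractC a c = bim_ract a (?\<phi> c))"
      using hom by (simp add: bim_lact_def bim_ract_def)
  next
    fix \<psi>
    assume \<psi>: "\<psi> \<in> extensional (carrier C) \<and> \<psi> \<in> algebra_homs F C (Bim_gAlt F A) \<and>
      (\<forall>c\<in>carrier C. \<forall>a\<in>carrier A.
        lactC c a = bim_lact (\<psi> c) a \<and> ractC a c = bim_ract a (\<psi> c))"
    show "\<psi> = ?\<phi>"
    proof (rule extensionalityI[where A = "carrier C"])
      fix c assume c: "c \<in> carrier C"
      have "\<psi> c \<in> carrier (Bim_gAlt F A)"
        using \<psi> c by (auto simp: algebra_homs_def linear_maps_def)
      then obtain f where f: "f \<in> centroid F A" "\<psi> c = (f, f)" by (auto simp: Bim_sel)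
      \<comment> \<open>The value of \<open>\<psi>\<close> is a diagonal pair, so \<open>f\<close>
        has to be both the left and the right action of c.\<close>
      have "f = (\<lambda>a\<in>carrier A. lactC c a)" "f = (\<lambda>a\<in>carrier A. ractC a c)"
        using \<psi> c f(2)
        by (auto simp: bim_lact_def bim_ract_def
            intro!: extensionalityI[OF centroidD(2)[OF f(1)]])
      then show "\<psi> c = ?\<phi> c"
        using c f(2) by simp
    qed (use \<psi> in auto)
  qed
qed

lemma Bim_is_actor: "is_actor TYPE('t) F A (Bim_gAlt F A) bim_lact bim_ract"
  unfolding is_actor_def using Bim_derived_action Bim_universal by blast

end

theorem theorem6p4:
  fixes F :: "('k, 'f) ring_scheme" and A :: "('k, 'a, 'm) module_scheme"
  assumes "g_alternative_algebra F A"
    and "anticommutative A"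
    and "Ann A = {\<zero>\<^bsub>A\<^esub>}"
  shows "(\<exists>(B :: ('k, ('a \<Rightarrow> 'a) \<times> ('a \<Rightarrow> 'a)) module) lact ract.
            is_actor TYPE('c) F A B lact ract) \<and>
         is_actor TYPE('c) F A (Bim_gAlt F A) bim_lact bim_ract"
proof -
  interpret anticommutative_g_alternative_algebra F A
    by (intro anticommutative_g_alternative_algebra.intro
        anticommutative_g_alternative_algebra_axioms.intro assms)
  show ?thesis
    using Bim_is_actor by blast
qed

end
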